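(* Let $0\le \alpha < \frac13$. Then there exist a nonnegative function $f \in BV(\mathbb{R})$ and a point $x_{\alpha}\in\mathbb{R}$ such that $x_\alpha$ is a local maximum of $M^{\alpha} f$, but $M^{\alpha} f(x_\alpha) > f(x_\alpha)$.
   Context: For a real $\alpha\ge 0$ and $f:\mathbb{R}\to\mathbb{R}$ locally integrable, the nontangential maximal function is $$M^{\alpha} f(x) = \sup_{(y,t):\ t>0,\ |x-y|\le \alpha t} \frac{1}{2t}\int_{y-t}^{y+t} |f(s)|\,ds .$$ The total variation of $g:\mathbb{R}\to\mathbb{R}$ is $\mathcal{V}(g) = \sup \sum_{i=1}^{N-1} |g(x_{i+1})-g(x_i)|$ over all finite sequences $x_1<\dots<x_N$. $BV(\mathbb{R})$ is the space of functions $f:\mathbb{R}\to\mathbb{R}$ that agree almost everywhere with some $g$ such that $\mathcal{V}(g)<\infty$. Functions in $BV(\mathbb{R})$ are taken to be normalized: $f(x) = \limsup_{y\to x,\, y\neq x} g(y)$ for every $x$, where $g=f$ a.e. and $\mathcal{V}(g)<\infty$. *)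

theory Defs
  imports "HOL-Analysis.Analysis"
begin

text \<open>The value is an extended real: it is infinite where the averages are unbounded. The integral
  is taken with respect to \<^const>\<open>lebesgue\<close>, so that \<open>f\<close> need only be Lebesgue
  (not Borel) measurable. For \<open>\<alpha> = 0\<close> only centred intervals occur.\<close>

definition nontangential_maximal :: "real \<Rightarrow> (real \<Rightarrow> real) \<Rightarrow> real \<Rightarrow> ereal" where
  "nontangential_maximal \<alpha> f x =
     (SUP (y, t) \<in> {(y, t). t > 0 \<and> \<bar>x - y\<bar> \<le> \<alpha> * t}.
        ereal (1 / (2 * t) * (LINT s:{y - t..y + t}|lebesgue. \<bar>f s\<bar>)))"

definition total_variation :: "(real \<Rightarrow> real) \<Rightarrow> ereal" where
  "total_variation g =
     (SUP xs \<in> {xs. xs \<noteq> [] \<and> sorted_wrt (<) xs}.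
        ereal (\<Sum>i<length xs - 1. \<bar>g (xs ! (i + 1)) - g (xs ! i)\<bar>))"

definition BV :: "(real \<Rightarrow> real) set" where
  "BV = {f. \<exists>g. (AE x in lebesgue. f x = g x) \<and> total_variation g < \<infinity>}"

text \<open>The filter \<open>at x\<close> is punctured, so the upper limit ignores the value of \<open>g\<close> at \<open>x\<close>.
  It is the larger of the two one-sided limits of \<open>g\<close>, and so does not depend on the choice of
  the representative \<open>g\<close> of finite variation.\<close>

definition BV_normalized :: "(real \<Rightarrow> real) \<Rightarrow> bool" where
  "BV_normalized f \<longleftrightarrow>
     (\<exists>g. (AE x in lebesgue. f x = g x) \<and> total_variation g < \<infinity> \<and>
          (\<forall>x. ereal (f x) = Limsup (at x) (\<lambda>y. ereal (g y))))"

definition local_maximum_at :: "(real \<Rightarrow> 'b::order) \<Rightarrow> real \<Rightarrow> bool" where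
  "local_maximum_at h x \<longleftrightarrow> (\<exists>\<epsilon>>0. \<forall>y. \<bar>y - x\<bar> < \<epsilon> \<longrightarrow> h y \<le> h x)"

end

theory Submission
  imports Defs
begin

text \<open>Take \<open>f\<close> to be the indicator of \<open>[-2,-1] \<union> [1,2]\<close> and the point \<open>0\<close>, where \<open>f\<close> vanishes
  while the interval \<open>[-2,2]\<close> has average \<open>1/2\<close>. An interval \<open>[c,d]\<close> containing \<open>0\<close> never has a larger
  average, since the bump in \<open>[0,d]\<close> has mass at most \<open>d/2\<close>, and similarly on the left. When
  \<open>\<alpha> < 1/3\<close>, an interval admissible for a point of \<open>(-1/3,1/3)\<close> that misses \<open>0\<close> is so short that it lies
  in \<open>(-1,1)\<close>, where its average is \<open>0\<close>. So the maximal function is at most \<open>1/2\<close> on \<open>(-1/3,1/3)\<close>.\<close>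

text \<open>Increments of \<open>g\<close> are dominated by those of \<open>h\<close>, and the
  latter telescope to a difference of two values in [0, K].\<close>

lemma total_variation_le_of_mono_bound:
  fixes g h :: "real \<Rightarrow> real"
  assumes bound: "\<And>x y. x \<le> y \<Longrightarrow> \<bar>g y - g x\<bar> \<le> h y - h x"
    and range: "\<And>x. 0 \<le> h x" "\<And>x. h x \<le> K"
  shows "total_variation g \<le> ereal K"
  unfolding total_variation_def
proof (rule SUP_least)
  fix xs :: "real list"
  assume "xs \<in> {xs. xs \<noteq> [] \<and> sorted_wrt (<) xs}"
  then have "sorted_wrt (<) xs" by simp
  then have le: "xs ! i \<le> xs ! Suc i" if "i < length xs - 1" for i
    using that by (auto intro: less_imp_le simp: sorted_wrt_nth_less)
  have "(\<Sum>i<length xs - 1. \<bar>g (xs ! (i + 1)) - g (xs ! i)\<bar>)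
      \<le> (\<Sum>i<length xs - 1. h (xs ! Suc i) - h (xs ! i))"
    by (rule sum_mono) (simp add: bound le)
  also have "\<dots> = h (xs ! (length xs - 1)) - h (xs ! 0)"
    by (rule sum_lessThan_telescope)
  also have "\<dots> \<le> K"
    using range[of "xs ! 0"] range[of "xs ! (length xs - 1)"] by linarith
  finally show "ereal (\<Sum>i<length xs - 1. \<bar>g (xs ! (i + 1)) - g (xs ! i)\<bar>) \<le> ereal K"
    by simp
qed

text \<open>This makes the indicator its own normalized representative. The filter
  \<open>at x\<close> ignores the value at \<open>x\<close>, so a point of \<open>S\<close> must be
  approached by other points of \<open>S\<close>; off \<open>S\<close>, the indicator vanishes
  nearby.\<close>

lemma Limsup_indicator_perfect:
  fixes S :: "'a::perfect_space set"
  assumes "closed S" and "\<And>x. x \<in> S \<Longrightarrow> x islimpt S"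
  shows "Limsup (at x) (\<lambda>y. ereal (indicator S y)) = ereal (indicator S x)"
proof (cases "x \<in> S")
  case True
  then have freq: "\<exists>\<^sub>F y in at x. y \<in> S"
    using assms(2) islimpt_conv_frequently_at by blast
  have "1 \<le> Limsup (at x) (\<lambda>y. ereal (indicator S y))"
  proof (rule Limsup_greatest)
    fix P assume "eventually P (at x)"
    with freq have "\<exists>\<^sub>F y in at x. P y \<and> y \<in> S"
      by (rule frequently_eventually_conj)
    from frequently_ex[OF this] obtain y where "P y" "y \<in> S"
      by blast
    then show "1 \<le> (SUP y\<in>Collect P. ereal (indicator S y))"
      by (intro SUP_upper2[of y]) simp_all
  qed
  moreover have "Limsup (at x) (\<lambda>y. ereal (indicator S y)) \<le> 1"
    by (rule Limsup_bounded) (simp add: indicator_def)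
  ultimately show ?thesis
    using True by (simp add: antisym one_ereal_def)
next
  case False
  then have "eventually (\<lambda>y. y \<in> - S) (at x)"
    using assms(1) by (intro eventually_at_in_open') auto
  then have "Limsup (at x) (\<lambda>y. ereal (indicator S y)) = Limsup (at x) (\<lambda>_. 0)"
    by (intro Limsup_eq) (auto elim: eventually_mono)
  then show ?thesis
    using False by (simp add: Limsup_const)
qed

abbreviation twin :: "real set" where
  "twin \<equiv> {-2..-1} \<union> {1..2}"

lemma twin_islimpt: "x \<in> twin \<Longrightarrow> x islimpt twin"
  by (auto simp: islimpt_Un islimpt_Icc)

lemma total_variation_twin: "total_variation (indicator twin) \<le> ereal 4"
  \<comment> \<open>\<open>h\<close> has a unit jump at each of the four endpoints. Its half-lines
    are closed where \<open>twin\<close> is entered and open where it is left, so \<open>h\<close>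
    jumps on the same side as the indicator.\<close>
  by (rule total_variation_le_of_mono_bound
      [where h = "\<lambda>x. indicator {-2..} x + indicator {-1<..} x + indicator {1..} x + indicator {2<..} x"])
    (auto simp: indicator_def)

lemma average_twin:
  fixes c d :: real
  shows "(LINT s:{c..d}|lebesgue. \<bar>indicator twin s\<bar>) = measure lebesgue ({c..d} \<inter> twin)"
proof -
  have "(\<lambda>s. indicator {c..d} s *\<^sub>R \<bar>indicator twin s\<bar>) = (indicator ({c..d} \<inter> twin) :: real \<Rightarrow> real)"
    by (auto simp: indicator_def)
  then show ?thesis
    unfolding set_lebesgue_integral_def by (simp only: integral_indicator) simp
qed

lemma measure_twin_le:
  fixes c d :: real
  assumes "c \<le> 0" and "0 \<le> d"
  shows "measure lebesgue ({c..d} \<inter> twin) \<le> (d - c) / 2"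
proof -
  have "{c..d} \<inter> twin = {max c (-2)..-1} \<union> {1..min d 2}"
    using assms by auto
  then have "measure lebesgue ({c..d} \<inter> twin)
      \<le> measure lebesgue {max c (-2)..-1} + measure lebesgue {1..min d 2}"
    by (simp only:) (rule measure_Un_le; simp)
  \<comment> \<open>The right piece has length 0 for d < 1, d - 1 for 1 \<le> d \<le> 2, and 1
    beyond: at most d / 2 in each case. The left piece is its mirror image.\<close>
  also have "\<dots> \<le> - c / 2 + d / 2"
    using assms by (intro add_mono) (auto simp: max_def min_def split: if_splits)
  finally show ?thesis by (simp add: field_simps)
qed

lemma nontangential_maximal_twin_le:
  assumes "\<alpha> < 1 / 3" and "\<bar>x\<bar> < 1 / 3"
  shows "nontangential_maximal \<alpha> (indicator twin) x \<le> ereal (1 / 2)"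
  unfolding nontangential_maximal_def average_twin
proof (rule SUP_least, clarify)
  fix y t :: real
  assume t: "t > 0" and "\<bar>x - y\<bar> \<le> \<alpha> * t"
  then have near: "\<bar>x - y\<bar> < t / 3"
    using assms(1) mult_strict_right_mono[of \<alpha> "1 / 3" t] by linarith
  have "measure lebesgue ({y - t..y + t} \<inter> twin) \<le> t"
  proof (cases "y - t \<le> 0 \<and> 0 \<le> y + t")
    case True
    then show ?thesis using measure_twin_le[of "y - t" "y + t"] by simp
  next
    case False
    \<comment> \<open>If y - t > 0, then t < y < x + t / 3 gives t < 1 / 2, hence y + t < x + 4 t /
      3 < 1. The case y + t < 0 is symmetric.\<close>
    then have "{y - t..y + t} \<inter> twin = {}"
      using near assms(2) t by (auto simp: abs_if split: if_splits)
    then show ?thesis using t by simp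
  qed
  then show "ereal (1 / (2 * t) * measure lebesgue ({y - t..y + t} \<inter> twin)) \<le> ereal (1 / 2)"
    using t by (simp add: field_simps)
qed

lemma nontangential_maximal_twin_0_ge:
  assumes "0 \<le> \<alpha>"
  shows "ereal (1 / 2) \<le> nontangential_maximal \<alpha> (indicator twin) 0"
  unfolding nontangential_maximal_def average_twin
\<comment> \<open>The interval [-2, 2] is centred at 0, hence admissible for every \<alpha> \<ge> 0,
  and contains both bumps.\<close>
proof (rule SUP_upper2[where i = "(0, 2)"])
  have "{-2..-1} \<inter> {1..2::real} = {}" by auto
  then have "measure lebesgue twin = 2"
    by (subst measure_Un3) (auto simp: fmeasurable_def)
  moreover have "{-2..2} \<inter> twin = twin" by auto
  ultimately show "ereal (1 / 2) \<le> (case (0, 2) of (y, t) \<Rightarrow>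
      ereal (1 / (2 * t) * measure lebesgue ({y - t..y + t} \<inter> twin)))"
    by simp
qed (use assms in simp)

theorem theorem2:
  fixes \<alpha> :: real
  assumes "0 \<le> \<alpha>" and "\<alpha> < 1 / 3"
  shows "\<exists>(f :: real \<Rightarrow> real) (x\<^sub>\<alpha> :: real).
           f \<in> BV \<and> BV_normalized f \<and> (\<forall>x. 0 \<le> f x) \<and>
           local_maximum_at (nontangential_maximal \<alpha> f) x\<^sub>\<alpha> \<and>
           nontangential_maximal \<alpha> f x\<^sub>\<alpha> > ereal (f x\<^sub>\<alpha>)"
proof (intro exI conjI)
  let ?f = "indicator twin :: real \<Rightarrow> real"
  have tv: "total_variation ?f < \<infinity>"
    using total_variation_twin by (rule order.strict_trans1) simp
  then show "?f \<in> BV"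
    unfolding BV_def by blast
  have "Limsup (at x) (\<lambda>y. ereal (?f y)) = ereal (?f x)" for x
    by (rule Limsup_indicator_perfect[OF _ twin_islimpt]) auto
  with tv show "BV_normalized ?f"
    unfolding BV_normalized_def by (intro exI[of _ ?f]) simp
  show "\<forall>x. 0 \<le> ?f x" by simp
  note ge = nontangential_maximal_twin_0_ge[OF assms(1)]
  have "nontangential_maximal \<alpha> ?f y \<le> nontangential_maximal \<alpha> ?f 0" if "\<bar>y - 0\<bar> < 1 / 3" for y
    using nontangential_maximal_twin_le[OF assms(2), of y] that ge by (auto intro: order.trans)
  then show "local_maximum_at (nontangential_maximal \<alpha> ?f) 0"
    unfolding local_maximum_at_def by (intro exI[of _ "1 / 3"]) simp
  have "ereal (?f 0) < ereal (1 / 2)" by simp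
  then show "ereal (?f 0) < nontangential_maximal \<alpha> ?f 0"
    using ge by (rule order.strict_trans2)
qed

end
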